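(* Let $H$ be a grid subgraph on $r$ rows and $c$ columns which can be obtained (up to relabeling rows and columns) by finitely many row/column-bridging operations starting from the grid subgraph consisting of a single vertex (one row, one column, no edges). Then $\operatorname{gr}(H,K_k)=k^{O(2^{r+c})}$; explicitly, $\operatorname{gr}(H,K_k)\le 2^{2^{r+c}-2}k^{2^{r+c-3}}$ for all $k\ge 1$.
   Context: A grid subgraph on $c$ columns and $r$ rows is a graph whose vertex set is a subset of $[c]\times[r]$ (vertex $(x,y)$ in column $x$, row $y$) and whose edges each join two vertices in the same row or in the same column. $G_{N\times N}=K_N\square K_N$; a spanning grid subgraph is a spanning subgraph of it. An embedding of $H$ (on $c_H$ columns, $r_H$ rows) into $G$ is a pair of injections $\varphi_c:[c_H]\to[c_G]$, $\varphi_r:[r_H]\to[r_G]$ sending every edge $\{(x,y),(x',y')\}$ of $H$ to an edge $\{(\varphi_c(x),\varphi_r(y)),(\varphi_c(x'),\varphi_r(y'))\}$ of $G$; $G$ contains $H$ if one exists. A coclique of size $k$ is a set of $k$ pairwise non-adjacent vertices all in one row or all in one column. $\operatorname{gr}(H,K_k)$ is the least $N$ such that every spanning grid subgraph of $G_{N\times N}$ contains $H$ or a coclique of size $k$. Column-bridging: for $H$ on $c$ columns and $r$ rows, $c_*\in[c]$, $y\in[r]$, bridging column $c_*$ at row $y$ yields $H'$ on $c+1$ columns and $r$ rows with edges: all edges of $H$; $\{(a,b),(c+1,b)\}$ whenever $\{(a,b),(c_*,b)\}\in E(H)$; $\{(c+1,b),(c+1,e)\}$ whenever $\{(c_*,b),(c_*,e)\}\in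 E(H)$; and $\{(c_*,y),(c+1,y)\}$. Row-bridging is defined analogously with rows and columns exchanged. *)

theory Defs
  imports Complex_Main
begin

record grid_graph =
  ncols :: nat
  nrows :: nat
  gverts :: "(nat \<times> nat) set"
  gedges :: "(nat \<times> nat) set set"

definition grid_subgraph :: "grid_graph \<Rightarrow> bool" where
  "grid_subgraph G \<longleftrightarrow>
     gverts G \<subseteq> {1..ncols G} \<times> {1..nrows G} \<and>
     (\<forall>e\<in>gedges G. \<exists>u v. e = {u, v} \<and> u \<noteq> v \<and> u \<in> gverts G \<and> v \<in> gverts G \<and>
        (fst u = fst v \<or> snd u = snd v))"

text \<open>The rook's graph: the Cartesian product of two complete graphs on \<open>N\<close> vertices.\<close>

definition complete_grid :: "nat \<Rightarrow> grid_graph" where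
  "complete_grid N =
     \<lparr> ncols = N, nrows = N, gverts = {1..N} \<times> {1..N},
       gedges = {{u, v} | u v. u \<in> {1..N} \<times> {1..N} \<and> v \<in> {1..N} \<times> {1..N} \<and> u \<noteq> v \<and>
                   (fst u = fst v \<or> snd u = snd v)} \<rparr>"

definition spanning_grid_subgraph :: "nat \<Rightarrow> grid_graph \<Rightarrow> bool" where
  "spanning_grid_subgraph N G \<longleftrightarrow>
     ncols G = N \<and> nrows G = N \<and>
     gverts G = gverts (complete_grid N) \<and> gedges G \<subseteq> gedges (complete_grid N)"

definition grid_embedding :: "grid_graph \<Rightarrow> grid_graph \<Rightarrow> (nat \<Rightarrow> nat) \<Rightarrow> (nat \<Rightarrow> nat) \<Rightarrow> bool" where
  "grid_embedding H G \<phi>c \<phi>r \<longleftrightarrow>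
     \<phi>c ` {1..ncols H} \<subseteq> {1..ncols G} \<and> inj_on \<phi>c {1..ncols H} \<and>
     \<phi>r ` {1..nrows H} \<subseteq> {1..nrows G} \<and> inj_on \<phi>r {1..nrows H} \<and>
     (\<forall>x y x' y'. {(x, y), (x', y')} \<in> gedges H \<longrightarrow>
        {(\<phi>c x, \<phi>r y), (\<phi>c x', \<phi>r y')} \<in> gedges G)"

definition grid_contains :: "grid_graph \<Rightarrow> grid_graph \<Rightarrow> bool" where
  "grid_contains G H \<longleftrightarrow> (\<exists>\<phi>c \<phi>r. grid_embedding H G \<phi>c \<phi>r)"

definition grid_coclique :: "grid_graph \<Rightarrow> nat \<Rightarrow> (nat \<times> nat) set \<Rightarrow> bool" where
  "grid_coclique G k S \<longleftrightarrow>
     S \<subseteq> gverts G \<and> finite S \<and> card S = k \<and>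
     (\<forall>u\<in>S. \<forall>v\<in>S. u \<noteq> v \<longrightarrow> {u, v} \<notin> gedges G) \<and>
     ((\<exists>x. \<forall>v\<in>S. fst v = x) \<or> (\<exists>y. \<forall>v\<in>S. snd v = y))"

definition grid_ramsey_property :: "grid_graph \<Rightarrow> nat \<Rightarrow> nat \<Rightarrow> bool" where
  "grid_ramsey_property H k N \<longleftrightarrow>
     (\<forall>G. spanning_grid_subgraph N G \<longrightarrow> grid_contains G H \<or> (\<exists>S. grid_coclique G k S))"

definition gr :: "grid_graph \<Rightarrow> nat \<Rightarrow> nat" where
  "gr H k = (LEAST N. grid_ramsey_property H k N)"

text \<open>Bridging duplicates the vertices of the bridged line along with its edges. Adding the two
  ends of the bridge explicitly only matters if the bridged position is not a vertex, which never
  happens for graphs built from a single vertex.\<close>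

definition bridge_column :: "nat \<Rightarrow> nat \<Rightarrow> grid_graph \<Rightarrow> grid_graph" where
  "bridge_column cs y H = (let c = ncols H in
     \<lparr> ncols = c + 1, nrows = nrows H,
       gverts = gverts H \<union> {(c + 1, b) | b. (cs, b) \<in> gverts H} \<union> {(cs, y), (c + 1, y)},
       gedges = gedges H
         \<union> {{(a, b), (c + 1, b)} | a b. {(a, b), (cs, b)} \<in> gedges H}
         \<union> {{(c + 1, b), (c + 1, e)} | b e. {(cs, b), (cs, e)} \<in> gedges H}
         \<union> {{(cs, y), (c + 1, y)}} \<rparr>)"

definition bridge_row :: "nat \<Rightarrow> nat \<Rightarrow> grid_graph \<Rightarrow> grid_graph" where
  "bridge_row rs x H = (let r = nrows H in
     \<lparr> ncols = ncols H, nrows = r + 1,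
       gverts = gverts H \<union> {(a, r + 1) | a. (a, rs) \<in> gverts H} \<union> {(x, rs), (x, r + 1)},
       gedges = gedges H
         \<union> {{(a, b), (a, r + 1)} | a b. {(a, b), (a, rs)} \<in> gedges H}
         \<union> {{(a, r + 1), (d, r + 1)} | a d. {(a, rs), (d, rs)} \<in> gedges H}
         \<union> {{(x, rs), (x, r + 1)}} \<rparr>)"

definition single_vertex :: grid_graph where
  "single_vertex = \<lparr> ncols = 1, nrows = 1, gverts = {(1, 1)}, gedges = {} \<rparr>"

inductive bridged :: "grid_graph \<Rightarrow> bool" where
  base: "bridged single_vertex"
| column: "\<lbrakk> bridged H; cs \<in> {1..ncols H}; y \<in> {1..nrows H} \<rbrakk> \<Longrightarrow> bridged (bridge_column cs y H)"
| row: "\<lbrakk> bridged H; rs \<in> {1..nrows H}; x \<in> {1..ncols H} \<rbrakk> \<Longrightarrow> bridged (bridge_row rs x H)"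

definition grid_relabeling :: "grid_graph \<Rightarrow> grid_graph \<Rightarrow> bool" where
  "grid_relabeling H H' \<longleftrightarrow>
     ncols H' = ncols H \<and> nrows H' = nrows H \<and>
     (\<exists>p q. bij_betw p {1..ncols H} {1..ncols H} \<and> bij_betw q {1..nrows H} {1..nrows H} \<and>
        gverts H' = map_prod p q ` gverts H \<and>
        gedges H' = (\<lambda>e. map_prod p q ` e) ` gedges H)"

definition bridging_constructible :: "grid_graph \<Rightarrow> bool" where
  "bridging_constructible H \<longleftrightarrow> (\<exists>H0. bridged H0 \<and> grid_relabeling H0 H)"

end

theory Submission
  imports Defs "HOL-Analysis.Convex"
begin

text \<open>Let \<open>G\<close> be an \<open>M \<times> M\<close> grid without a coclique of size \<open>k\<close>, let \<open>T(H)\<close> be the number of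
  embeddings of \<open>H\<close> on \<open>n\<close> lines into \<open>G\<close>, and let \<open>H'\<close> arise from \<open>H\<close> by bridging a column. Fix an
  embedding of everything but the bridged column, and let \<open>A\<close> be the set of columns completing it to
  an embedding of \<open>H\<close>. Two members of \<open>A\<close> that are adjacent in the image of the bridging row give an
  embedding of \<open>H'\<close>, and since that row has no coclique of size \<open>k\<close>, a Turan bound yields at least
  \<open>|A|\<^sup>2 / k - |A|\<close> ordered pairs of this kind. Summing with Cauchy-Schwarz gives
  \<open>T(H)\<^sup>2 \<le> M^(n-1) k (T(H') + T(H))\<close>. As long as \<open>M\<close> is at least \<open>2 k\<close> divided by the density
  \<open>T(H) / M^n\<close>, the embeddings of \<open>H'\<close> therefore have density at least \<open>1 / (2 k)\<close> times the square
  of that of \<open>H\<close>. Rows are handled by transposing, and \<open>M = (2 k)^(2^(r+c-3))\<close> suffices at every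
  step.\<close>

section \<open>A Turan bound and Cauchy-Schwarz over the naturals\<close>

text \<open>Turan's theorem for graphs whose independent sets have at most \<open>k\<close>
  elements, with loops counted among the related pairs. By induction on \<open>k\<close>, delete the
  closed neighbourhood \<open>N v\<close> of a vertex of minimum degree: every independent subset of
  the rest \<open>B\<close> can be extended by \<open>v\<close>, so the bound on independent sets
  drops by one.\<close>

lemma card_sq_le_related_pairs:
  fixes R :: "'a \<Rightarrow> 'a \<Rightarrow> bool"
  assumes refl: "\<And>a. R a a" and sym: "\<And>a b. R a b \<Longrightarrow> R b a"
  shows "finite A \<Longrightarrow>
    (\<And>S. S \<subseteq> A \<Longrightarrow> (\<And>a b. a \<in> S \<Longrightarrow> b \<in> S \<Longrightarrow> a \<noteq> b \<Longrightarrow> \<not> R a b) \<Longrightarrow> card S \<le> k) \<Longrightarrow>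
    (card A)\<^sup>2 \<le> k * card {(a, b) \<in> A \<times> A. R a b}"
proof (induction k arbitrary: A)
  case 0
  have "A = {}"
  proof (rule ccontr)
    assume "A \<noteq> {}"
    then obtain v where "v \<in> A" by blast
    then show False using "0.prems"(2)[of "{v}"] by simp
  qed
  then show ?case by simp
next
  case (Suc k)
  show ?case
  proof (cases "A = {}")
    case True
    then show ?thesis by simp
  next
    case False
    define N where "N v = {b \<in> A. R v b}" for v
    have finN: "finite (N v)" for v
      using Suc.prems(1) by (simp add: N_def)
    obtain v where v: "v \<in> A" and vmin: "\<And>u. u \<in> A \<Longrightarrow> card (N v) \<le> card (N u)"
      using arg_min_if_finite[OF Suc.prems(1) False, of "\<lambda>u. card (N u)"]
      by (meson not_le)
    define B where "B = A - N v"
    have finB: "finite B" using Suc.prems(1) by (simp add: B_def)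
    define D where "D = card {(a, b) \<in> A \<times> A. R a b}"
    define D' where "D' = card {(a, b) \<in> B \<times> B. R a b}"
    have IH: "(card B)\<^sup>2 \<le> k * D'"
      unfolding D'_def
    proof (rule Suc.IH[OF finB])
      fix S assume S: "S \<subseteq> B" and ind: "\<And>a b. a \<in> S \<Longrightarrow> b \<in> S \<Longrightarrow> a \<noteq> b \<Longrightarrow> \<not> R a b"
      have "v \<notin> S" using S v refl by (auto simp: B_def N_def)
      moreover have "card (insert v S) \<le> Suc k"
        using S v ind sym by (intro Suc.prems(2)) (auto simp: B_def N_def)
      ultimately show "card S \<le> k"
        using finite_subset[OF S finB] by simp
    qed
    \<comment> \<open>By minimality each \<open>u\<close> in \<open>N v\<close> has at least
      \<open>card (N v)\<close> relatives in \<open>A\<close>. The related pairs starting in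
      \<open>N v\<close> are disjoint from those inside \<open>B\<close>, so the two counts add up
      to at most \<open>D\<close>.\<close>
    have "card (N v) ^ 2 = (\<Sum>u\<in>N v. card (N v))" by (simp add: power2_eq_square)
    also have "\<dots> \<le> (\<Sum>u\<in>N v. card (N u))"
      by (intro sum_mono vmin) (simp add: N_def)
    also have "\<dots> = card (Sigma (N v) N)" using finN by simp
    finally have "card (N v) ^ 2 + D' \<le> card (Sigma (N v) N) + D'" by simp
    also have "\<dots> = card (Sigma (N v) N \<union> {(a, b) \<in> B \<times> B. R a b})"
      unfolding D'_def
    proof (rule card_Un_disjoint[symmetric])
      show "finite {(a, b) \<in> B \<times> B. R a b}"
        by (rule finite_subset[of _ "B \<times> B"]) (use finB in auto)
    qed (use finN in \<open>auto simp: B_def\<close>)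
    also have "\<dots> \<le> D"
      unfolding D_def
    proof (rule card_mono)
      show "finite {(a, b) \<in> A \<times> A. R a b}"
        by (rule finite_subset[of _ "A \<times> A"]) (use Suc.prems(1) in auto)
    qed (auto simp: B_def N_def)
    finally have le_D: "card (N v) ^ 2 + D' \<le> D" .
    have card_A: "card A = card (N v) + card B"
      unfolding B_def using Suc.prems(1) finN
      by (subst card_Diff_subset) (auto simp: N_def card_mono)
    \<comment> \<open>This is the cross term of the square of \<open>card (N v) + card B\<close>.
      Apply AM-GM to \<open>k * card (N v)\<close> and \<open>card B\<close>, bound the square of
      \<open>card B\<close> by \<open>IH\<close>, and cancel \<open>k\<close>. For
      \<open>k = 0\<close> the set \<open>B\<close> is empty.\<close>
    have "2 * card (N v) * card B \<le> k * card (N v) ^ 2 + D'"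
    proof (cases "k = 0")
      case True
      then show ?thesis using IH by simp
    next
      case False
      have "k * (2 * card (N v) * card B) \<le> (k * card (N v))\<^sup>2 + (card B)\<^sup>2"
      proof -
        have "2 * x * y \<le> x\<^sup>2 + y\<^sup>2" for x y :: nat
        proof -
          have "real (2 * x * y) \<le> real (x\<^sup>2 + y\<^sup>2)"
            using sum_squares_bound[of "real x" "real y"] by simp
          then show ?thesis by (simp only: of_nat_le_iff)
        qed
        from this[of "k * card (N v)" "card B"] show ?thesis by (simp add: mult_ac)
      qed
      also have "\<dots> \<le> (k * card (N v))\<^sup>2 + k * D'" using IH by simp
      also have "\<dots> = k * (k * card (N v) ^ 2 + D')"
        by (simp add: power2_eq_square algebra_simps)
      finally show ?thesis using False by simp
    qed
    then have "(card A)\<^sup>2 \<le> Suc k * (card (N v) ^ 2 + D')"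
      using IH by (simp add: card_A power2_sum algebra_simps)
    also have "\<dots> \<le> Suc k * D" using le_D by (rule mult_le_mono2)
    finally show ?thesis by (simp only: D_def)
  qed
qed

lemma sum_nat_squared_le:
  fixes f :: "'a \<Rightarrow> nat"
  shows "(\<Sum>i\<in>I. f i)\<^sup>2 \<le> card I * (\<Sum>i\<in>I. (f i)\<^sup>2)"
proof (cases "finite I")
  case True
  have "real ((\<Sum>i\<in>I. f i)\<^sup>2) \<le> real (card I * (\<Sum>i\<in>I. (f i)\<^sup>2))"
    using sum_squared_le_sum_of_squares[of "\<lambda>i. real (f i)" I] by (simp add: mult.commute)
  then show ?thesis by (simp only: of_nat_le_iff)
qed simp

section \<open>Embeddings as a finite set to be counted\<close>

text \<open>Fixing the value \<open>undefined\<close> off the lines of \<open>H\<close> identifies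
  maps that agree on these lines, so the set is finite and each embedding is counted once.\<close>

definition embeddings :: "grid_graph \<Rightarrow> grid_graph \<Rightarrow> ((nat \<Rightarrow> nat) \<times> (nat \<Rightarrow> nat)) set" where
  "embeddings H G = {(f, g). f \<in> extensional {1..ncols H} \<and> g \<in> extensional {1..nrows H} \<and>
     grid_embedding H G f g}"

lemma embeddings_subset:
  "embeddings H G \<subseteq> ({1..ncols H} \<rightarrow>\<^sub>E {1..ncols G}) \<times> ({1..nrows H} \<rightarrow>\<^sub>E {1..nrows G})"
  by (auto simp: embeddings_def grid_embedding_def PiE_def)

lemma finite_embeddings: "finite (embeddings H G)"
  by (rule finite_subset[OF embeddings_subset]) (simp add: finite_PiE)

text \<open>Since every edge of a grid subgraph is a doubleton, mapping whole edges is equivalent to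
  mapping coordinates, and case analyses on edges need not order the two ends.\<close>

lemma grid_embedding_iff_image:
  assumes "grid_subgraph H"
  shows "grid_embedding H G f g \<longleftrightarrow>
    f ` {1..ncols H} \<subseteq> {1..ncols G} \<and> inj_on f {1..ncols H} \<and>
    g ` {1..nrows H} \<subseteq> {1..nrows G} \<and> inj_on g {1..nrows H} \<and>
    (\<forall>e\<in>gedges H. map_prod f g ` e \<in> gedges G)"
proof -
  have "(\<forall>x y x' y'. {(x, y), (x', y')} \<in> gedges H \<longrightarrow> {(f x, g y), (f x', g y')} \<in> gedges G)
    \<longleftrightarrow> (\<forall>e\<in>gedges H. map_prod f g ` e \<in> gedges G)" (is "?L \<longleftrightarrow> ?R")
  proof
    assume L: ?L
    show ?R
    proof
      fix e assume e: "e \<in> gedges H"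
      then obtain u v where "e = {u, v}"
        using assms unfolding grid_subgraph_def by blast
      then show "map_prod f g ` e \<in> gedges G"
        using L e by (cases u; cases v) auto
    qed
  next
    assume R: ?R
    show ?L
    proof (intro allI impI)
      fix x y x' y' assume "{(x, y), (x', y')} \<in> gedges H"
      then have "map_prod f g ` {(x, y), (x', y')} \<in> gedges G" using R by blast
      then show "{(f x, g y), (f x', g y')} \<in> gedges G" by simp
    qed
  qed
  then show ?thesis by (simp add: grid_embedding_def)
qed

lemma grid_edgeE:
  assumes "grid_subgraph H" "e \<in> gedges H"
  obtains a b a' b' where "e = {(a, b), (a', b')}" "(a, b) \<noteq> (a', b')"
    "(a, b) \<in> gverts H" "(a', b') \<in> gverts H" "a = a' \<or> b = b'"
    "a \<in> {1..ncols H}" "b \<in> {1..nrows H}" "a' \<in> {1..ncols H}" "b' \<in> {1..nrows H}"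
proof -
  obtain u v where uv: "e = {u, v}" "u \<noteq> v" "u \<in> gverts H" "v \<in> gverts H"
      "fst u = fst v \<or> snd u = snd v"
    using assms unfolding grid_subgraph_def by blast
  moreover have "gverts H \<subseteq> {1..ncols H} \<times> {1..nrows H}"
    using assms unfolding grid_subgraph_def by blast
  moreover obtain a b a' b' where "u = (a, b)" "v = (a', b')"
    by (cases u; cases v)
  ultimately show thesis
    by (intro that[of a b a' b']) (simp_all add: subset_iff)
qed

section \<open>Exchanging rows and columns\<close>

definition transpose_grid :: "grid_graph \<Rightarrow> grid_graph" where
  "transpose_grid H = \<lparr> ncols = nrows H, nrows = ncols H,
     gverts = prod.swap ` gverts H, gedges = (`) prod.swap ` gedges H \<rparr>"

lemma transpose_grid_simps [simp]:
  "ncols (transpose_grid H) = nrows H" "nrows (transpose_grid H) = ncols H"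
  by (simp_all add: transpose_grid_def)

lemma gverts_transpose [simp]: "(a, b) \<in> gverts (transpose_grid H) \<longleftrightarrow> (b, a) \<in> gverts H"
  by (force simp: transpose_grid_def)

lemma swap_image_mem_gedges_transpose [simp]: "prod.swap ` e \<in> gedges (transpose_grid H) \<longleftrightarrow> e \<in> gedges H"
proof -
  have "inj ((`) (prod.swap :: nat \<times> nat \<Rightarrow> _))"
    by (rule inj_on_inverseI[where g = "(`) prod.swap"]) (simp add: image_image)
  then show ?thesis by (simp add: transpose_grid_def inj_image_mem_iff)
qed

lemma doubleton_mem_gedges_transpose [simp]:
  "{(a, b), (c, d)} \<in> gedges (transpose_grid H) \<longleftrightarrow> {(b, a), (d, c)} \<in> gedges H"
  using swap_image_mem_gedges_transpose[of "{(b, a), (d, c)}" H] by simp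

lemma transpose_transpose [simp]: "transpose_grid (transpose_grid H) = H"
  by (simp add: transpose_grid_def image_image)

lemma grid_embedding_transpose:
  "grid_embedding (transpose_grid H) (transpose_grid G) g f \<longleftrightarrow> grid_embedding H G f g"
  unfolding grid_embedding_def by auto

lemma card_embeddings_transpose:
  "card (embeddings (transpose_grid H) (transpose_grid G)) = card (embeddings H G)"
proof -
  have "embeddings (transpose_grid H) (transpose_grid G) = prod.swap ` embeddings H G"
    by (force simp: embeddings_def grid_embedding_transpose)
  then show ?thesis by (simp add: card_image)
qed

lemma grid_coclique_transpose:
  assumes "grid_coclique (transpose_grid G) k S"
  shows "grid_coclique G k (prod.swap ` S)"
proof -
  have ind: "{u, v} \<notin> gedges (transpose_grid G)" if "u \<in> S" "v \<in> S" "u \<noteq> v" for u v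
    using assms that by (simp add: grid_coclique_def)
  have "{prod.swap u, prod.swap v} \<notin> gedges G" if "u \<in> S" "v \<in> S" "u \<noteq> v" for u v
    using ind[OF that] by (cases u; cases v) simp
  moreover have "prod.swap ` S \<subseteq> gverts G"
  proof
    fix w assume "w \<in> prod.swap ` S"
    then obtain a b where "w = (b, a)" "(a, b) \<in> S" by auto
    then show "w \<in> gverts G" using assms by (auto simp: grid_coclique_def)
  qed
  moreover have "finite S" "card S = k" "(\<exists>x. \<forall>v\<in>S. fst v = x) \<or> (\<exists>y. \<forall>v\<in>S. snd v = y)"
    using assms by (auto simp: grid_coclique_def)
  ultimately show ?thesis
    unfolding grid_coclique_def by (auto simp: card_image)
qed

lemma bridge_row_eq_transpose:
  "bridge_row rs x H = transpose_grid (bridge_column rs x (transpose_grid H))"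
proof -
  have "gverts (bridge_row rs x H) = gverts (transpose_grid (bridge_column rs x (transpose_grid H)))"
    by (auto simp: bridge_row_def bridge_column_def Let_def)
  moreover have "gedges (bridge_row rs x H) = gedges (transpose_grid (bridge_column rs x (transpose_grid H)))"
  proof -
    \<comment> \<open>The second form also exchanges the bound variables: for the edges between old
      and new lines, the column and row definitions bind the two coordinates in opposite
      roles.\<close>
    have compr: "(`) prod.swap ` {F a b | a b. P a b} = {prod.swap ` F a b | a b. P a b}"
      and compr': "(`) prod.swap ` {F a b | a b. P a b} = {prod.swap ` F b a | a b. P b a}"
      for F :: "nat \<Rightarrow> nat \<Rightarrow> (nat \<times> nat) set" and P
      by blast+
    have new: "(`) prod.swap ` {{(a, b), (n, b)} | a b. {(a, b), (rs, b)} \<in> gedges (transpose_grid H)}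
      = {{(a, b), (a, n)} | a b. {(a, b), (a, rs)} \<in> gedges H}" for n :: nat
      by (subst compr') simp
    have copy: "(`) prod.swap ` {{(n, b), (n, e)} | b e. {(rs, b), (rs, e)} \<in> gedges (transpose_grid H)}
      = {{(b, n), (e, n)} | b e. {(b, rs), (e, rs)} \<in> gedges H}" for n :: nat
      by (subst compr) simp
    have H: "(`) prod.swap ` gedges (transpose_grid H) = gedges H"
      by (simp add: transpose_grid_def image_image)
    have "gedges (transpose_grid (bridge_column rs x (transpose_grid H))) =
      (`) prod.swap ` gedges (bridge_column rs x (transpose_grid H))"
      by (simp add: transpose_grid_def)
    also have "\<dots> = gedges (bridge_row rs x H)"
      unfolding bridge_row_def bridge_column_def Let_def grid_graph.simps image_Un new copy H
      by simp
    finally show ?thesis by simp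
  qed
  ultimately show ?thesis
    by (simp add: bridge_row_def bridge_column_def transpose_grid_def Let_def)
qed

lemma gedges_doubletonD:
  assumes "grid_subgraph H" "{u, v} \<in> gedges H"
  shows "u \<in> gverts H" "v \<in> gverts H" "u \<noteq> v" "fst u = fst v \<or> snd u = snd v"
proof -
  obtain u' v' where "{u, v} = {u', v'}" "u' \<noteq> v'" "u' \<in> gverts H" "v' \<in> gverts H"
    "fst u' = fst v' \<or> snd u' = snd v'"
    using assms unfolding grid_subgraph_def by blast
  then show "u \<in> gverts H" "v \<in> gverts H" "u \<noteq> v" "fst u = fst v \<or> snd u = snd v"
    by (auto simp: doubleton_eq_iff)
qed

lemma grid_subgraph_transpose:
  assumes "grid_subgraph H"
  shows "grid_subgraph (transpose_grid H)"
  unfolding grid_subgraph_def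
proof (intro conjI ballI)
  show "gverts (transpose_grid H) \<subseteq> {1..ncols (transpose_grid H)} \<times> {1..nrows (transpose_grid H)}"
    using assms unfolding grid_subgraph_def by auto
next
  fix e assume "e \<in> gedges (transpose_grid H)"
  then obtain e' where e: "e = prod.swap ` e'" and e': "e' \<in> gedges H"
    by (auto simp: transpose_grid_def)
  obtain a b a' b' where "e' = {(a, b), (a', b')}" "(a, b) \<noteq> (a', b')"
    "(a, b) \<in> gverts H" "(a', b') \<in> gverts H" "a = a' \<or> b = b'"
    using grid_edgeE[OF assms e'] by metis
  then show "\<exists>u v. e = {u, v} \<and> u \<noteq> v \<and> u \<in> gverts (transpose_grid H) \<and>
      v \<in> gverts (transpose_grid H) \<and> (fst u = fst v \<or> snd u = snd v)"
    by (intro exI[of _ "(b, a)"] exI[of _ "(b', a')"]) (auto simp: e)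
qed

section \<open>Column-bridging: well-formedness and extension of embeddings\<close>

lemma bridge_column_simps [simp]:
  "ncols (bridge_column cs y H) = ncols H + 1" "nrows (bridge_column cs y H) = nrows H"
  by (simp_all add: bridge_column_def Let_def)

lemma bridge_row_simps [simp]:
  "ncols (bridge_row rs x H) = ncols H" "nrows (bridge_row rs x H) = nrows H + 1"
  by (simp_all add: bridge_row_def Let_def)

lemma gedges_bridge_columnE [consumes 1, case_names old new copy bridge]:
  assumes "e \<in> gedges (bridge_column cs y H)"
  obtains "e \<in> gedges H"
  | a b where "e = {(a, b), (ncols H + 1, b)}" "{(a, b), (cs, b)} \<in> gedges H"
  | b d where "e = {(ncols H + 1, b), (ncols H + 1, d)}" "{(cs, b), (cs, d)} \<in> gedges H"
  | "e = {(cs, y), (ncols H + 1, y)}"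
  using assms unfolding bridge_column_def Let_def by auto

lemma grid_subgraph_bridge_column:
  assumes H: "grid_subgraph H" and cs: "cs \<in> {1..ncols H}" and y: "y \<in> {1..nrows H}"
  shows "grid_subgraph (bridge_column cs y H)"
proof -
  let ?H = "bridge_column cs y H"
  have V: "gverts H \<subseteq> {1..ncols H} \<times> {1..nrows H}"
    using H by (simp add: grid_subgraph_def)
  have old: "gverts H \<subseteq> gverts ?H" and copy: "(cs, b) \<in> gverts H \<Longrightarrow> (ncols H + 1, b) \<in> gverts ?H"
    and ends: "(cs, y) \<in> gverts ?H" "(ncols H + 1, y) \<in> gverts ?H" for b
    by (auto simp: bridge_column_def Let_def)
  have "gverts ?H \<subseteq> {1..ncols ?H} \<times> {1..nrows ?H}"
    using V cs y by (auto simp: bridge_column_def Let_def)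
  moreover have "\<exists>u v. e = {u, v} \<and> u \<noteq> v \<and> u \<in> gverts ?H \<and> v \<in> gverts ?H \<and>
      (fst u = fst v \<or> snd u = snd v)" if "e \<in> gedges ?H" for e
    using that
  proof (cases rule: gedges_bridge_columnE)
    case old
    then obtain u v where "e = {u, v}" "u \<noteq> v" "u \<in> gverts H" "v \<in> gverts H"
      "fst u = fst v \<or> snd u = snd v"
      using H unfolding grid_subgraph_def by blast
    then show ?thesis using \<open>gverts H \<subseteq> gverts ?H\<close> by blast
  next
    case (new a b)
    note D = gedges_doubletonD[OF H new(2)]
    show ?thesis
      using D(1,2) V old copy new(1)
      by (intro exI[of _ "(a, b)"] exI[of _ "(ncols H + 1, b)"]) auto
  next
    case (copy b d)
    note D = gedges_doubletonD[OF H copy(2)]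
    show ?thesis
      using D(1,2,3) \<open>\<And>b. (cs, b) \<in> gverts H \<Longrightarrow> (ncols H + 1, b) \<in> gverts ?H\<close> copy(1)
      by (intro exI[of _ "(ncols H + 1, b)"] exI[of _ "(ncols H + 1, d)"]) auto
  next
    case bridge
    then show ?thesis
      using ends cs by (intro exI[of _ "(cs, y)"] exI[of _ "(ncols H + 1, y)"]) auto
  qed
  ultimately show ?thesis unfolding grid_subgraph_def by blast
qed

lemma bridged_grid_subgraph: "bridged H \<Longrightarrow> grid_subgraph H"
proof (induction rule: bridged.induct)
  case base
  then show ?case by (simp add: grid_subgraph_def single_vertex_def)
next
  case (column H cs y)
  then show ?case by (simp add: grid_subgraph_bridge_column)
next
  case (row H rs x)
  then show ?case
    unfolding bridge_row_eq_transpose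
    by (intro grid_subgraph_transpose grid_subgraph_bridge_column) auto
qed

lemma bridged_dims: "bridged H \<Longrightarrow> ncols H \<ge> 1 \<and> nrows H \<ge> 1"
  by (induction rule: bridged.induct) (auto simp: single_vertex_def)

text \<open>The two embeddings of \<open>H\<close> differ only at \<open>cs\<close>. In the combined
  map the old edges are handled by the first, the edges at the copy of \<open>cs\<close> by the
  second, and the bridge by the adjacency of columns \<open>a\<close> and \<open>b\<close> in row
  \<open>g y\<close>.\<close>

lemma bridge_column_embedding:
  assumes H: "grid_subgraph H" and cs: "cs \<in> {1..ncols H}" and y: "y \<in> {1..nrows H}"
    and emb: "grid_embedding H G (f(cs := a)) g" "grid_embedding H G (f(cs := b)) g"
    and ab: "a \<noteq> b" "{(a, g y), (b, g y)} \<in> gedges G"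
  shows "grid_embedding (bridge_column cs y H) G (f(cs := a, ncols H + 1 := b)) g"
proof -
  let ?n = "ncols H + 1"
  let ?f = "f(cs := a, ?n := b)"
  note E = emb[unfolded grid_embedding_iff_image[OF H]]
  have range1: "(f(cs := a)) ` {1..ncols H} \<subseteq> {1..ncols G}" and inj1: "inj_on (f(cs := a)) {1..ncols H}"
    and edges1: "\<And>e. e \<in> gedges H \<Longrightarrow> map_prod (f(cs := a)) g ` e \<in> gedges G"
    using E(1) by blast+
  have range2: "(f(cs := b)) ` {1..ncols H} \<subseteq> {1..ncols G}" and inj2: "inj_on (f(cs := b)) {1..ncols H}"
    and edges2: "\<And>e. e \<in> gedges H \<Longrightarrow> map_prod (f(cs := b)) g ` e \<in> gedges G"
    using E(2) by blast+
  have g: "g ` {1..nrows H} \<subseteq> {1..nrows G}" "inj_on g {1..nrows H}"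
    using E(1) by blast+
  have cols: "{1..?n} = insert ?n {1..ncols H}" by auto
  have eq: "?f x = (f(cs := a)) x" if "x \<in> {1..ncols H}" for x using that by auto
  have img: "?f ` {1..ncols H} = (f(cs := a)) ` {1..ncols H}" using eq by (rule image_cong[OF refl])
  have "b \<in> (f(cs := b)) ` {1..ncols H}" using cs by force
  then have b: "b \<in> {1..ncols G}" using range2 by blast
  have "?f ` {1..?n} \<subseteq> {1..ncols G}"
    unfolding cols image_insert img using b range1 by simp
  moreover have "inj_on ?f {1..?n}"
  proof -
    have "inj_on ?f {1..ncols H}" 
      using inj1 inj_on_cong[of "{1..ncols H}" ?f "f(cs := a)", OF eq] by blast
    \<comment> \<open>Columns other than \<open>cs\<close> have the same image under both
      embeddings, and the second one, being injective, already uses \<open>b\<close> for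
      \<open>cs\<close>.\<close>
    moreover have "b \<notin> (f(cs := a)) ` {1..ncols H}"
    proof
      assume "b \<in> (f(cs := a)) ` {1..ncols H}"
      then obtain x where x: "x \<in> {1..ncols H}" "b = (f(cs := a)) x" by blast
      with ab(1) have "x \<noteq> cs" by auto
      with x have "(f(cs := b)) x = (f(cs := b)) cs" by simp
      with inj2 x(1) cs \<open>x \<noteq> cs\<close> show False by (meson inj_onD)
    qed
    ultimately show ?thesis unfolding cols by (auto simp: img[symmetric])
  qed
  moreover have "map_prod ?f g ` e \<in> gedges G" if "e \<in> gedges (bridge_column cs y H)" for e
    using that
  proof (cases rule: gedges_bridge_columnE)
    case old
    obtain p q p' q' where "e = {(p, q), (p', q')}" "p \<in> {1..ncols H}" "p' \<in> {1..ncols H}"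
      using grid_edgeE[OF H old] by metis
    then have "map_prod ?f g ` e = map_prod (f(cs := a)) g ` e" by auto
    then show ?thesis using edges1[OF old] by simp
  next
    case (new p q)
    \<comment> \<open>As \<open>p\<close> is neither \<open>cs\<close> nor the new column, the image
      of this edge is that of \<open>{(p, q), (cs, q)}\<close> under the second embedding.\<close>
    have p: "p \<in> {1..ncols H}" "p \<noteq> cs"
      using gedges_doubletonD[OF H new(2)] H by (auto simp: grid_subgraph_def)
    then show ?thesis using edges2[OF new(2)] new(1) by auto
  next
    case (copy p q)
    then show ?thesis using edges2[OF copy(2)] by auto
  next
    case bridge
    then show ?thesis using ab(2) cs by auto
  qed
  ultimately show ?thesis
    unfolding grid_embedding_iff_image[OF grid_subgraph_bridge_column[OF H cs y]]
    using g by simp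
qed

section \<open>Counting embeddings of a bridged graph\<close>

lemma independent_row_card_less:
  assumes G: "gverts G = {1..M} \<times> {1..M}" and no: "\<nexists>S. grid_coclique G k S"
    and S: "S \<subseteq> {1..M}" and t: "t \<in> {1..M}"
    and ind: "\<And>a b. a \<in> S \<Longrightarrow> b \<in> S \<Longrightarrow> a \<noteq> b \<Longrightarrow> {(a, t), (b, t)} \<notin> gedges G"
  shows "card S < k"
proof (rule ccontr)
  assume "\<not> card S < k"
  \<comment> \<open>Cocliques have size exactly \<open>k\<close>, so a larger independent set is cut
    down first.\<close>
  then obtain S' where S': "S' \<subseteq> S" "card S' = k" "finite S'"
    by (meson obtain_subset_with_card_n not_less)
  have "grid_coclique G k ((\<lambda>a. (a, t)) ` S')"
    unfolding grid_coclique_def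
  proof (intro conjI)
    show "(\<lambda>a. (a, t)) ` S' \<subseteq> gverts G" using S' S t G by auto
    show "card ((\<lambda>a. (a, t)) ` S') = k" using S' by (simp add: card_image inj_on_def)
  qed (use S' ind in auto)
  then show False using no by blast
qed

text \<open>Fibre the embeddings of \<open>H\<close> over the choice of all lines but
  \<open>cs\<close>, apply the Turan bound in each fibre and sum by Cauchy-Schwarz. Off-diagonal
  related pairs in a fibre are embeddings of the bridged graph.\<close>

lemma card_embeddings_bridge_column:
  assumes G: "ncols G = M" "nrows G = M" "gverts G = {1..M} \<times> {1..M}"
    and no: "\<nexists>S. grid_coclique G k S"
    and H: "grid_subgraph H" and cs: "cs \<in> {1..ncols H}" and y: "y \<in> {1..nrows H}"
  shows "(card (embeddings H G))\<^sup>2 \<le> M ^ (ncols H + nrows H - 1) *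
    (k * (card (embeddings (bridge_column cs y H) G) + card (embeddings H G)))"
proof -
  let ?n = "ncols H + 1"
  define P where "P = (({1..ncols H} - {cs}) \<rightarrow>\<^sub>E {1..M}) \<times> ({1..nrows H} \<rightarrow>\<^sub>E {1..M})"
  define A where "A p = {a. ((fst p)(cs := a), snd p) \<in> embeddings H G}" for p
  define D where "D p = {(a, b). (a, b) \<in> A p \<times> A p \<and> (a = b \<or> {(a, snd p y), (b, snd p y)} \<in> gedges G)}" for p
  define D' where "D' p = {(a, b). (a, b) \<in> A p \<times> A p \<and> a \<noteq> b \<and> {(a, snd p y), (b, snd p y)} \<in> gedges G}" for p
  have finP: "finite P" unfolding P_def by (simp add: finite_PiE)
  have cardP: "card P = M ^ (ncols H + nrows H - 1)"
  proof -
    have "card P = M ^ (ncols H - 1) * M ^ nrows H"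
      unfolding P_def using cs by (simp add: card_PiE card_cartesian_product)
    also have "\<dots> = M ^ (ncols H + nrows H - 1)"
      using cs by (simp flip: power_add)
    finally show ?thesis .
  qed
  have A_sub: "A p \<subseteq> {1..M}" for p
  proof
    fix a assume "a \<in> A p"
    then have "(fst p)(cs := a) \<in> {1..ncols H} \<rightarrow>\<^sub>E {1..M}"
      using embeddings_subset[of H G] G by (auto simp: A_def)
    then have "((fst p)(cs := a)) cs \<in> {1..M}" using cs by (rule PiE_mem)
    then show "a \<in> {1..M}" by simp
  qed
  have finA: "finite (A p)" for p by (rule finite_subset[OF A_sub]) simp
  have finD': "finite (D' p)" for p
    by (rule finite_subset[of _ "A p \<times> A p"]) (auto simp: D'_def finA)
  have "(card (A p))\<^sup>2 \<le> k * card (D p)" if p: "p \<in> P" for p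
    unfolding D_def
  proof (rule card_sq_le_related_pairs[OF _ _ finA])
    fix S assume "S \<subseteq> A p" and "\<And>a b. a \<in> S \<Longrightarrow> b \<in> S \<Longrightarrow> a \<noteq> b \<Longrightarrow>
      \<not> (a = b \<or> {(a, snd p y), (b, snd p y)} \<in> gedges G)"
    moreover have "snd p y \<in> {1..M}" using p y by (auto simp: P_def PiE_def)
    ultimately have "card S < k"
      using A_sub by (intro independent_row_card_less[OF G(3) no, of S "snd p y"]) blast+
    then show "card S \<le> k" by simp
  qed (auto simp: insert_commute)
  moreover have "card (D p) = card (D' p) + card (A p)" for p
  proof -
    have "D p = D' p \<union> (\<lambda>a. (a, a)) ` A p" by (auto simp: D_def D'_def)
    moreover have "card (D' p \<union> (\<lambda>a. (a, a)) ` A p) = card (D' p) + card ((\<lambda>a. (a, a)) ` A p)"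
      by (rule card_Un_disjoint) (auto simp: finD' finA, auto simp: D'_def)
    ultimately show ?thesis by (simp add: card_image inj_on_def)
  qed
  ultimately have sq: "(card (A p))\<^sup>2 \<le> k * (card (D' p) + card (A p))" if "p \<in> P" for p
    using that by metis
  have sumA: "card (embeddings H G) = (\<Sum>p\<in>P. card (A p))"
  proof -
    have "bij_betw (\<lambda>(p, a). ((fst p)(cs := a), snd p)) (Sigma P A) (embeddings H G)"
    \<comment> \<open>The inverse stores \<open>f cs\<close> separately and resets it to
      \<open>undefined\<close>, the value that extensionality on the remaining columns forces
      there.\<close>
    proof (rule bij_betwI[where g = "\<lambda>(f, g). ((f(cs := undefined), g), f cs)"])
      show "(\<lambda>(f, g). ((f(cs := undefined), g), f cs)) \<in> embeddings H G \<rightarrow> Sigma P A"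
      proof
        fix w assume w: "w \<in> embeddings H G"
        obtain f g where fg: "w = (f, g)" by (cases w)
        have "f \<in> {1..ncols H} \<rightarrow>\<^sub>E {1..M}" "g \<in> {1..nrows H} \<rightarrow>\<^sub>E {1..M}"
          using w embeddings_subset[of H G] G by (auto simp: fg)
        then show "(\<lambda>(f, g). ((f(cs := undefined), g), f cs)) w \<in> Sigma P A"
          using w by (auto simp: fg P_def A_def PiE_def extensional_def)
      qed
    next
      fix w assume "w \<in> Sigma P A"
      then obtain f g a where "w = ((f, g), a)" "f \<in> ({1..ncols H} - {cs}) \<rightarrow>\<^sub>E {1..M}"
        by (auto simp: P_def)
      moreover from this have "f cs = undefined" by (auto simp: PiE_def extensional_def)
      ultimately show "(\<lambda>(f, g). ((f(cs := undefined), g), f cs))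
          ((\<lambda>(p, a). ((fst p)(cs := a), snd p)) w) = w"
        by (auto simp: fun_upd_idem)
    qed (auto simp: A_def)
    then have "card (embeddings H G) = card (Sigma P A)" by (simp add: bij_betw_same_card)
    then show ?thesis using finP finA by simp
  qed
  have sumD: "(\<Sum>p\<in>P. card (D' p)) \<le> card (embeddings (bridge_column cs y H) G)"
  proof -
    let ?F = "\<lambda>(p, (a, b)). ((fst p)(cs := a, ?n := b), snd p)"
    \<comment> \<open>A lower bound for the number of embeddings of the bridged graph is wanted, so
      an injection suffices.\<close>
    have "card (Sigma P D') \<le> card (embeddings (bridge_column cs y H) G)"
    proof (rule card_inj_on_le[OF _ _ finite_embeddings])
      show "?F ` Sigma P D' \<subseteq> embeddings (bridge_column cs y H) G"
      proof clarsimp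
        fix f g a b assume "(f, g) \<in> P" and D: "(a, b) \<in> D' (f, g)"
        then have ext: "f \<in> extensional ({1..ncols H} - {cs})" "g \<in> extensional {1..nrows H}"
          by (auto simp: P_def PiE_def)
        have "grid_embedding H G (f(cs := a)) g" "grid_embedding H G (f(cs := b)) g" "a \<noteq> b"
          "{(a, g y), (b, g y)} \<in> gedges G"
          using D by (auto simp: D'_def A_def embeddings_def)
        then have "grid_embedding (bridge_column cs y H) G (f(cs := a, ?n := b)) g"
          by (rule bridge_column_embedding[OF H cs y])
        moreover have "f(cs := a, ?n := b) \<in> extensional {1..?n}"
          using ext(1) cs by (auto simp: extensional_def)
        ultimately show "(f(cs := a, Suc (ncols H) := b), g) \<in> embeddings (bridge_column cs y H) G"
          using ext(2) by (simp add: embeddings_def)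
      qed
      show "inj_on ?F (Sigma P D')"
      proof (rule inj_onI)
        fix v w assume v: "v \<in> Sigma P D'" and w: "w \<in> Sigma P D'" and eq: "?F v = ?F w"
        obtain f g a b where v': "v = ((f, g), a, b)" by (metis prod.exhaust)
        obtain f' g' a' b' where w': "w = ((f', g'), a', b')" by (metis prod.exhaust)
        have ext: "f \<in> extensional ({1..ncols H} - {cs})" "f' \<in> extensional ({1..ncols H} - {cs})"
          using v w by (auto simp: v' w' P_def PiE_def)
        have E: "f(cs := a, ?n := b) = f'(cs := a', ?n := b')" "g = g'"
          using eq by (simp_all add: v' w')
        have "a = a'" "b = b'"
          using fun_cong[OF E(1), of cs] fun_cong[OF E(1), of ?n] cs by (auto split: if_splits)
        moreover have "f x = f' x" for x
        proof (cases "x \<in> {1..ncols H} - {cs}")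
          case True
          then show ?thesis using fun_cong[OF E(1), of x] by auto
        next
          case False
          then show ?thesis using extensional_arb[OF ext(1)] extensional_arb[OF ext(2)] by metis
        qed
        ultimately show "v = w" using E(2) by (auto simp: v' w')
      qed
    qed
    then show ?thesis using finP finD' by simp
  qed
  have "(card (embeddings H G))\<^sup>2 \<le> card P * (\<Sum>p\<in>P. (card (A p))\<^sup>2)"
    unfolding sumA by (rule sum_nat_squared_le)
  also have "\<dots> \<le> card P * (\<Sum>p\<in>P. k * (card (D' p) + card (A p)))"
    by (intro mult_le_mono2 sum_mono sq)
  also have "\<dots> = card P * (k * ((\<Sum>p\<in>P. card (D' p)) + card (embeddings H G)))"
    by (simp add: sumA sum.distrib flip: sum_distrib_left)
  also have "\<dots> \<le> card P * (k * (card (embeddings (bridge_column cs y H) G) + card (embeddings H G)))"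
    using sumD by simp
  finally show ?thesis unfolding cardP .
qed

section \<open>The density recursion\<close>

text \<open>A division-free form, with \<open>X\<close> standing for \<open>M ^ (n - 1)\<close> and
  \<open>1 / Q\<close> for a lower bound on the density of \<open>H\<close>. From
  \<open>2 * k * Q \<le> M\<close> one gets \<open>2 * k * X \<le> T\<close>, so the degenerate term
  \<open>k * X * T\<close> takes at most half of the square of \<open>T\<close>. What remains
  squares the density and loses a factor \<open>2 * k\<close>.\<close>

lemma bridging_count_arith:
  fixes M X k Q T T' :: nat
  assumes TQ: "X * M \<le> T * Q" and M: "2 * k * Q \<le> M" and X: "X > 0" and Q: "Q > 0"
    and T: "T\<^sup>2 \<le> X * (k * (T' + T))"
  shows "X * M\<^sup>2 \<le> T' * (2 * k * Q\<^sup>2)"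
proof -
  have "(2 * k * X) * Q = X * (2 * k * Q)" by simp
  also have "\<dots> \<le> X * M" using M by (rule mult_le_mono2)
  also note TQ
  finally have "2 * k * X \<le> T" using Q by simp
  then have "2 * k * X * T \<le> T * T" by (rule mult_le_mono1)
  moreover have "T * T \<le> k * X * T' + k * X * T"
    using T by (simp add: power2_eq_square algebra_simps)
  ultimately have T2: "T\<^sup>2 \<le> 2 * k * X * T'"
    unfolding power2_eq_square mult.assoc by linarith
  have "X * (X * M\<^sup>2) = (X * M)\<^sup>2" by (simp add: power2_eq_square)
  also have "\<dots> \<le> (T * Q)\<^sup>2" using TQ by (rule power_mono) simp
  also have "\<dots> = T\<^sup>2 * Q\<^sup>2" by (rule power_mult_distrib)
  also have "\<dots> \<le> 2 * k * X * T' * Q\<^sup>2" using T2 by (rule mult_le_mono1)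
  also have "\<dots> = X * (T' * (2 * k * Q\<^sup>2))" by simp
  finally show ?thesis using X by simp
qed

text \<open>The reciprocal density \<open>(2 * k) ^ (2 ^ (n - 2) - 1)\<close> solves the recursion
  sending \<open>Q\<close> to \<open>2 * k * Q ^ 2\<close> with value 1 at \<open>n = 2\<close>. The
  threshold on \<open>M\<close> is exactly \<open>2 * k * Q\<close>.\<close>

lemma bridging_step_arith:
  fixes M k n T T' :: nat
  assumes IH: "M ^ n \<le> T * (2 * k) ^ (2 ^ (n - 2) - 1)"
    and M: "(2 * k) ^ 2 ^ (n + 1 - 3) \<le> M" and k: "k > 0" and n: "n \<ge> 2"
    and T: "T\<^sup>2 \<le> M ^ (n - 1) * (k * (T' + T))"
  shows "M ^ (n + 1) \<le> T' * (2 * k) ^ (2 ^ (n + 1 - 2) - 1)"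
proof -
  \<comment> \<open>Writing \<open>n = m + 2\<close> eliminates the truncated subtractions from
    \<open>n\<close>.\<close>
  obtain m where m: "n = Suc (Suc m)" using n by (metis Suc_le_D numeral_2_eq_2 Suc_le_mono)
  let ?Q = "(2 * k) ^ (2 ^ m - 1)"
  have exp1: "Suc (2 ^ m - 1) = (2 :: nat) ^ m" by simp
  have exp2: "Suc ((2 ^ m - 1) * 2) = (2 :: nat) ^ Suc m - 1"
    using exp1 by (simp del: Suc_pred add: diff_mult_distrib)
  have Q1: "2 * k * ?Q = (2 * k) ^ 2 ^ m"
    using exp1 by (metis power_Suc)
  have Q2: "2 * k * ?Q\<^sup>2 = (2 * k) ^ (2 ^ Suc m - 1)"
  proof -
    have "2 * k * ?Q\<^sup>2 = (2 * k) ^ Suc ((2 ^ m - 1) * 2)" by (simp only: power_Suc power_mult)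
    then show ?thesis by (simp only: exp2)
  qed
  have "(2 * k) ^ 2 ^ m > 0" using k by simp
  then have "M > 0" using M unfolding m by (intro less_le_trans[OF _ M]) simp
  have "M ^ (n - 1) * M\<^sup>2 \<le> T' * (2 * k * ?Q\<^sup>2)"
  proof (rule bridging_count_arith[OF _ _ _ _ T])
    show "M ^ (n - 1) * M \<le> T * ?Q" using IH unfolding m by (simp add: mult.commute)
    show "2 * k * ?Q \<le> M" unfolding Q1 using M by (simp add: m)
  qed (use \<open>M > 0\<close> k in simp_all)
  then show ?thesis unfolding Q2 by (simp add: m power2_eq_square mult_ac)
qed

section \<open>Density bound for all bridged graphs\<close>

lemma gverts_transpose_square:
  "gverts G = {1..M} \<times> {1..M} \<Longrightarrow> gverts (transpose_grid G) = {1..M} \<times> {1..M}"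
  by auto

lemma card_embeddings_bridge_row:
  assumes G: "ncols G = M" "nrows G = M" "gverts G = {1..M} \<times> {1..M}"
    and no: "\<nexists>S. grid_coclique G k S"
    and H: "grid_subgraph H" and rs: "rs \<in> {1..nrows H}" and x: "x \<in> {1..ncols H}"
  shows "(card (embeddings H G))\<^sup>2 \<le> M ^ (ncols H + nrows H - 1) *
    (k * (card (embeddings (bridge_row rs x H) G) + card (embeddings H G)))"
proof -
  have "card (embeddings (bridge_column rs x (transpose_grid H)) (transpose_grid G)) =
      card (embeddings (bridge_row rs x H) G)"
    unfolding bridge_row_eq_transpose
    using card_embeddings_transpose[of "transpose_grid (bridge_column rs x (transpose_grid H))" G]
    by simp
  moreover have "\<nexists>S. grid_coclique (transpose_grid G) k S"
    using no grid_coclique_transpose by blast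
  ultimately show ?thesis
    using card_embeddings_bridge_column[of "transpose_grid G" M k "transpose_grid H" rs x]
      G gverts_transpose_square[of G M] grid_subgraph_transpose[OF H] rs x
    by (simp add: card_embeddings_transpose add.commute)
qed

lemma card_embeddings_single_vertex:
  assumes "ncols G = M" "nrows G = M"
  shows "card (embeddings single_vertex G) = M\<^sup>2"
proof -
  have "embeddings single_vertex G = ({1} \<rightarrow>\<^sub>E {1..M}) \<times> ({1} \<rightarrow>\<^sub>E {1..M})"
    using assms
    by (auto simp: embeddings_def grid_embedding_def single_vertex_def PiE_def)
  then show ?thesis by (simp add: card_cartesian_product card_PiE power2_eq_square)
qed

text \<open>The exponent of the threshold grows with the number of lines, so an \<open>M\<close>
  large enough for the final graph serves all intermediate ones. The guard exempts two lines, where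
  truncated subtraction makes the exponent 1. The single vertex has density 1.\<close>

lemma card_embeddings_bridged:
  assumes G: "ncols G = M" "nrows G = M" "gverts G = {1..M} \<times> {1..M}"
    and no: "\<nexists>S. grid_coclique G k S" and k: "k > 0"
  shows "bridged H \<Longrightarrow> 3 \<le> ncols H + nrows H \<longrightarrow> (2 * k) ^ 2 ^ (ncols H + nrows H - 3) \<le> M \<Longrightarrow>
    M ^ (ncols H + nrows H) \<le>
      card (embeddings H G) * (2 * k) ^ (2 ^ (ncols H + nrows H - 2) - 1)"
proof (induction rule: bridged.induct)
  case base
  show ?case
    using G card_embeddings_single_vertex[of G M]
    by (simp add: single_vertex_def power2_eq_square)
next
  case (column H cs y)
  let ?n = "ncols H + nrows H"
  have n: "2 \<le> ?n" using bridged_dims[OF column.hyps(1)] by linarith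
  have M: "(2 * k) ^ 2 ^ (?n + 1 - 3) \<le> M" using column.prems n by simp
  have "(2 * k) ^ 2 ^ (?n - 3) \<le> (2 * k) ^ 2 ^ (?n + 1 - 3)"
    using k by (intro power_increasing) auto
  then have "M ^ ?n \<le> card (embeddings H G) * (2 * k) ^ (2 ^ (?n - 2) - 1)"
    using M by (intro column.IH) simp
  from bridging_step_arith[OF this M k n card_embeddings_bridge_column[OF G no
        bridged_grid_subgraph[OF column.hyps(1)] column.hyps(2,3)]]
  show ?case by simp
next
  case (row H rs x)
  let ?n = "ncols H + nrows H"
  have n: "2 \<le> ?n" using bridged_dims[OF row.hyps(1)] by linarith
  have M: "(2 * k) ^ 2 ^ (?n + 1 - 3) \<le> M" using row.prems n by simp
  have "(2 * k) ^ 2 ^ (?n - 3) \<le> (2 * k) ^ 2 ^ (?n + 1 - 3)"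
    using k by (intro power_increasing) auto
  then have "M ^ ?n \<le> card (embeddings H G) * (2 * k) ^ (2 ^ (?n - 2) - 1)"
    using M by (intro row.IH) simp
  from bridging_step_arith[OF this M k n card_embeddings_bridge_row[OF G no
        bridged_grid_subgraph[OF row.hyps(1)] row.hyps(2,3)]]
  show ?case by simp
qed

section \<open>From counts to the Ramsey property, up to relabeling\<close>

lemma spanning_grid_subgraphD:
  assumes "spanning_grid_subgraph M G"
  shows "ncols G = M" "nrows G = M" "gverts G = {1..M} \<times> {1..M}"
  using assms by (simp_all add: spanning_grid_subgraph_def complete_grid_def)

text \<open>Without a coclique, the density bound at its own threshold \<open>M\<close> applies; as
  \<open>M\<close> is positive, the number of embeddings cannot be zero.\<close>

lemma bridged_ramsey_property:
  assumes H: "bridged H" and n: "3 \<le> ncols H + nrows H" and k: "k > 0"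
  shows "grid_ramsey_property H k ((2 * k) ^ 2 ^ (ncols H + nrows H - 3))"
  unfolding grid_ramsey_property_def
proof (intro allI impI)
  define M where "M = (2 * k) ^ 2 ^ (ncols H + nrows H - 3)"
  fix G assume "spanning_grid_subgraph ((2 * k) ^ 2 ^ (ncols H + nrows H - 3)) G"
  then have G: "spanning_grid_subgraph M G" by (simp only: M_def)
  show "grid_contains G H \<or> (\<exists>S. grid_coclique G k S)"
  proof (cases "\<exists>S. grid_coclique G k S")
    case False
    have "M ^ (ncols H + nrows H) \<le>
        card (embeddings H G) * (2 * k) ^ (2 ^ (ncols H + nrows H - 2) - 1)"
      by (rule card_embeddings_bridged[OF spanning_grid_subgraphD[OF G] False k H])
        (simp only: M_def order_refl simp_thms)
    moreover have "M > 0" using k by (simp add: M_def)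
    then have "M ^ (ncols H + nrows H) > 0" by simp
    ultimately have "embeddings H G \<noteq> {}" by (intro notI) simp
    then obtain f g where "(f, g) \<in> embeddings H G" by auto
    then show ?thesis by (auto simp: embeddings_def grid_contains_def)
  qed simp
qed

text \<open>Compose the embedding of \<open>H0\<close> with the inverses of the two relabeling
  permutations. These are inverses only on the index ranges, which contain all endpoints of
  edges.\<close>

lemma grid_contains_relabeling:
  assumes H0: "grid_subgraph H0" and H: "grid_subgraph H" and rel: "grid_relabeling H0 H"
    and G: "grid_contains G H0"
  shows "grid_contains G H"
proof -
  obtain p q where dims: "ncols H = ncols H0" "nrows H = nrows H0"
    and p: "bij_betw p {1..ncols H0} {1..ncols H0}" and q: "bij_betw q {1..nrows H0} {1..nrows H0}"
    and edges: "gedges H = (\<lambda>e. map_prod p q ` e) ` gedges H0"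
    using rel unfolding grid_relabeling_def by (elim conjE exE) (rule that)
  obtain f g where "grid_embedding H0 G f g" using G by (auto simp: grid_contains_def)
  note fg = this[unfolded grid_embedding_iff_image[OF H0]]
  let ?p = "inv_into {1..ncols H0} p" and ?q = "inv_into {1..nrows H0} q"
  have p': "bij_betw ?p {1..ncols H0} {1..ncols H0}" and q': "bij_betw ?q {1..nrows H0} {1..nrows H0}"
    by (rule bij_betw_inv_into[OF p], rule bij_betw_inv_into[OF q])
  have "map_prod (f \<circ> ?p) (g \<circ> ?q) ` e \<in> gedges G" if e: "e \<in> gedges H" for e
  proof -
    obtain e0 where e0: "e0 \<in> gedges H0" "e = map_prod p q ` e0" using e unfolding edges by blast
    obtain a b a' b' where ab: "e0 = {(a, b), (a', b')}"
      "a \<in> {1..ncols H0}" "b \<in> {1..nrows H0}" "a' \<in> {1..ncols H0}" "b' \<in> {1..nrows H0}"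
      using grid_edgeE[OF H0 e0(1)] by metis
    then have "map_prod (f \<circ> ?p) (g \<circ> ?q) ` e = map_prod f g ` e0"
      unfolding e0(2)
      by (simp add: bij_betw_inv_into_left[OF p] bij_betw_inv_into_left[OF q]
          del: atLeastAtMost_iff One_nat_def)
    then show ?thesis using fg e0(1) by simp
  qed
  moreover have "(f \<circ> ?p) ` {1..ncols H0} = f ` {1..ncols H0}" "(g \<circ> ?q) ` {1..nrows H0} = g ` {1..nrows H0}"
    using p' q' by (simp_all only: bij_betw_imp_surj_on flip: image_comp)
  moreover have "inj_on (f \<circ> ?p) {1..ncols H0}" "inj_on (g \<circ> ?q) {1..nrows H0}"
    using p' q' fg by (auto intro!: comp_inj_on simp: bij_betw_def)
  ultimately have "grid_embedding H G (f \<circ> ?p) (g \<circ> ?q)"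
    unfolding grid_embedding_iff_image[OF H] dims using fg by simp
  then show ?thesis by (auto simp: grid_contains_def)
qed

section \<open>Degenerate cases and the final bounds\<close>

text \<open>For \<open>k = 1\<close> every power of \<open>k\<close> is 1, so the asymptotic bound
  demands \<open>gr H 1 \<le> 1\<close>; one cell is already a coclique.\<close>

lemma grid_ramsey_property_one_coclique: "grid_ramsey_property H 1 1"
  unfolding grid_ramsey_property_def
proof (intro allI impI disjI2)
  fix G assume "spanning_grid_subgraph 1 G"
  then have "grid_coclique G 1 {(1, 1)}"
    by (auto simp: grid_coclique_def spanning_grid_subgraphD)
  then show "\<exists>S. grid_coclique G 1 S" ..
qed

text \<open>With two lines, natural subtraction would turn the general threshold into
  \<open>2 * k\<close>, which exceeds the claimed bound of 4 times the square root of
  \<open>k\<close> once \<open>k > 4\<close>. Having no edges, \<open>H\<close> embeds into a single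
  cell.\<close>

lemma grid_ramsey_property_one_by_one:
  assumes H: "grid_subgraph H" and dims: "ncols H = 1" "nrows H = 1"
  shows "grid_ramsey_property H k 1"
proof -
  have "e \<notin> gedges H" for e
  proof
    assume "e \<in> gedges H"
    then show False by (rule grid_edgeE[OF H]) (simp add: dims)
  qed
  then have "grid_embedding H G id id" if "spanning_grid_subgraph 1 G" for G
    using spanning_grid_subgraphD[OF that] dims by (auto simp: grid_embedding_def)
  then show ?thesis by (auto simp: grid_ramsey_property_def grid_contains_def)
qed

lemma ramsey_property_bridging_constructible:
  assumes H: "grid_subgraph H" and con: "bridging_constructible H" and k: "k \<ge> 1"
  shows "\<exists>N. grid_ramsey_property H k N \<and>
    real N \<le> 2 powr (2 ^ (nrows H + ncols H) - 2) * real k powr (2 powr (real (nrows H + ncols H) - 3))"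
proof -
  obtain H0 where H0: "bridged H0" and rel: "grid_relabeling H0 H"
    using con by (auto simp: bridging_constructible_def)
  have dims: "ncols H0 = ncols H" "nrows H0 = nrows H"
    using rel by (auto simp: grid_relabeling_def)
  define n where "n = nrows H + ncols H"
  have pos: "ncols H \<ge> 1" "nrows H \<ge> 1" using bridged_dims[OF H0] dims by auto
  show ?thesis
  proof (cases "n = 2")
    case True
    then have "ncols H = 1" "nrows H = 1" using pos by (auto simp: n_def)
    then have "grid_ramsey_property H k 1"
      by (rule grid_ramsey_property_one_by_one[OF H])
    moreover have "1 * 1 \<le> (2 :: real) powr (2 ^ n - 2) * real k powr (2 powr (real n - 3))"
      using k True by (intro mult_mono ge_one_powr_ge_zero) auto
    ultimately show ?thesis unfolding n_def by (intro exI[of _ 1]) simp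
  next
    case False
    then have n: "n \<ge> 3" using pos by (auto simp: n_def)
    let ?N = "(2 * k) ^ 2 ^ (n - 3)"
    have "grid_ramsey_property H0 k ?N"
      using bridged_ramsey_property[OF H0, of k] n k by (simp add: dims n_def add.commute)
    then have ramsey: "grid_ramsey_property H k ?N"
      using grid_contains_relabeling[OF bridged_grid_subgraph[OF H0] H rel]
      unfolding grid_ramsey_property_def by blast
    have n3: "2 powr (real n - 3) = real (2 ^ (n - 3))"
    proof -
      have "real n - 3 = real (n - 3)" using n by simp
      then show ?thesis by (simp only: powr_realpow of_nat_power of_nat_numeral zero_less_numeral)
    qed
    \<comment> \<open>The threshold carries the constant \<open>2 ^ 2 ^ (n - 3)\<close>. With
      \<open>x = 2 ^ (n - 3) \<ge> 1\<close>, the claimed exponent of 2 is \<open>8 * x - 2\<close>,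
      which is at least \<open>x\<close>.\<close>
    have "(2 :: real) ^ n = 8 * 2 ^ (n - 3)"
      using power_add[of "2 :: real" 3 "n - 3"] n by simp
    moreover have "(2 :: real) ^ (n - 3) \<ge> 1" by simp
    ultimately have exp: "real (2 ^ (n - 3)) \<le> 2 ^ n - 2"
      unfolding of_nat_power of_nat_numeral by linarith
    have "real ((2 * k) ^ m) = 2 powr real m * real k powr real m" for m
      using k by (simp add: power_mult_distrib powr_realpow)
    then have "real ?N = 2 powr real (2 ^ (n - 3)) * real k powr real (2 ^ (n - 3))" .
    also have "\<dots> \<le> 2 powr (2 ^ n - 2) * real k powr real (2 ^ (n - 3))"
      using exp by (intro mult_right_mono powr_mono) auto
    finally show ?thesis
      using ramsey unfolding n_def[symmetric] n3 by blast
  qed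
qed

theorem theorem3p3:
  "(\<exists>C::real. C > 0 \<and>
      (\<forall>(H::grid_graph) (k::nat) (r::nat) (c::nat).
        grid_subgraph H \<and> nrows H = r \<and> ncols H = c \<and> bridging_constructible H \<and> k \<ge> 1 \<longrightarrow>
          real (gr H k) \<le> real k powr (C * 2 ^ (r + c)))) \<and>
   (\<forall>(H::grid_graph) (k::nat) (r::nat) (c::nat).
      grid_subgraph H \<and> nrows H = r \<and> ncols H = c \<and> bridging_constructible H \<and> k \<ge> 1 \<longrightarrow>
        (\<exists>N. grid_ramsey_property H k N) \<and>
        real (gr H k) \<le>
          2 powr (2 ^ (r + c) - 2) * real k powr (2 powr (real (r + c) - 3)))"
proof -
  have gr_le: "gr H k \<le> N" if "grid_ramsey_property H k N" for H k N
    unfolding gr_def using that by (rule Least_le)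
  have explicit: "(\<exists>N. grid_ramsey_property H k N) \<and> real (gr H k) \<le>
      2 powr (2 ^ (nrows H + ncols H) - 2) * real k powr (2 powr (real (nrows H + ncols H) - 3))"
    if H: "grid_subgraph H" "bridging_constructible H" "k \<ge> 1" for H k
  proof -
    obtain N where N: "grid_ramsey_property H k N"
      "real N \<le> 2 powr (2 ^ (nrows H + ncols H) - 2) * real k powr (2 powr (real (nrows H + ncols H) - 3))"
      using ramsey_property_bridging_constructible[OF H] by blast
    moreover have "real (gr H k) \<le> real N" using gr_le[OF N(1)] by simp
    ultimately show ?thesis by (meson order_trans)
  qed
  \<comment> \<open>This is the asymptotic bound with \<open>C = 2\<close>. For
    \<open>k \<ge> 2\<close> the power of 2 is absorbed into \<open>k powr (2 ^ (r + c))\<close>,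
    and the other factor is at most the same power; \<open>k = 1\<close> absorbs no constant and is
    treated apart.\<close>
  have "real (gr H k) \<le> real k powr (2 * 2 ^ (nrows H + ncols H))"
    if H: "grid_subgraph H" "bridging_constructible H" "k \<ge> 1" for H k
  proof (cases "k = 1")
    case True
    then show ?thesis using gr_le[OF grid_ramsey_property_one_coclique, of H] by simp
  next
    case False
    then have k: "real k \<ge> 2" using H(3) by simp
    let ?n = "nrows H + ncols H"
    have "(2 :: real) powr (2 ^ ?n - 2) \<le> 2 powr (2 ^ ?n)" by (intro powr_mono) auto
    also have "\<dots> \<le> real k powr (2 ^ ?n)" using k by (intro powr_mono2) auto
    finally have 1: "(2 :: real) powr (2 ^ ?n - 2) \<le> real k powr (2 ^ ?n)" .
    have "(2 :: real) powr (real ?n - 3) \<le> 2 powr real ?n" by (intro powr_mono) auto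
    then have "(2 :: real) powr (real ?n - 3) \<le> 2 ^ ?n" by (simp only: powr_realpow zero_less_numeral)
    then have 2: "real k powr (2 powr (real ?n - 3)) \<le> real k powr (2 ^ ?n)"
      using k by (intro powr_mono) auto
    have "real (gr H k) \<le> 2 powr (2 ^ ?n - 2) * real k powr (2 powr (real ?n - 3))"
      using explicit[OF H] by simp
    also have "\<dots> \<le> real k powr (2 ^ ?n) * real k powr (2 ^ ?n)"
      using 1 2 by (intro mult_mono) auto
    also have "\<dots> = real k powr (2 * 2 ^ ?n)" by (simp flip: powr_add)
    finally show ?thesis .
  qed
  then show ?thesis using explicit by (intro conjI exI[of _ 2]) auto
qed

end
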